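(* Assume that $m \geq N$ and that the $m \times N$ matrix $B = (\nu_0\ \cdots\ \nu_{N-1})$ has full rank. Let $C = (\nu_1\ \cdots\ \nu_N)$ and let $$B = Q \begin{pmatrix} \hat R \\ 0 \end{pmatrix} = (Q_1\ \ Q_2)\begin{pmatrix} \hat R \\ 0 \end{pmatrix} = Q_1 \hat R$$ be a QR decomposition of $B$, with $Q \in \mathrm{M}(m\times m,\mathbb{R})$ orthogonal, $Q_1 \in \mathrm{M}(m \times N,\mathbb{R})$, $Q_2 \in \mathrm{M}(m\times (m-N),\mathbb{R})$ and $\hat R \in \mathrm{M}(N \times N,\mathbb{R})$ upper triangular. Let $A \in \mathrm{M}(m\times m,\mathbb{R})$ and let $\mu_t = \mathbb{E}(R_t)$, $t \in \{1,\dots,N\}$, be the expectations of the associated multi-step residuals. Then $\mu_1 = \dots = \mu_N = 0$ if and only if $$A = C \hat R^{-1} Q_1^\top + A_2 Q_2^\top \quad\text{for some } A_2 \in \mathrm{M}(m\times(m-N),\mathbb{R}).$$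
   Context: Setting: $f \colon \mathbb{R}^n \to \mathbb{R}^n$ is continuous, and $X \subset \mathbb{R}^n$ is non-empty, compact and forward invariant ($x \in X$ implies $f(x) \in X$). For $\bar{x} \in X$, $x(\cdot,\bar{x}) \colon \mathbb{N}_0 \to X$ denotes the trajectory $x(0,\bar x) = \bar x$, $x(t+1,\bar x) = f(x(t,\bar x))$. The functions $\psi_1,\dots,\psi_m \in L^2(X,\mathbb{R})$ are continuous and linearly independent, and the lift $\Psi \colon X \to \mathbb{R}^m$, $\Psi(x) = (\psi_1(x),\dots,\psi_m(x))^\top$, is assumed injective. Fixed sample points $x_1,\dots,x_L \in X$ with $L \ge m$ and a fixed horizon $N \in \mathbb{N}$ ($N \geq 1$) are given, and the $m \times L$ matrix $G_0 = (\Psi(x_1)\ \cdots\ \Psi(x_L))$ is assumed to have full row rank. $\mathrm{M}(p\times q,\mathbb{R})$ is the space of real $p \times q$ matrices. For $A \in \mathrm{M}(m\times m,\mathbb{R})$, $z(\cdot,\bar x)\colon \mathbb{N}_0 \to \mathbb{R}^m$ is defined by $z(0,\bar x) = \Psi(\bar x)$, $z(t+1,\bar x) = A z(t,\bar x)$. Expectations are taken with respect to the empirical probability measure $P_L = \frac1L \sum_{i=1}^L \delta_{x_i}$ on the Borel sets of $X$ ($\delta_{x_i}$ the Dirac measure at $x_i$), i.e. $\mathbb{E}(Y) = \frac1L\sum_{i=1}^L Y(x_i)$. Multi-step residual: $R_t \colon X \to \mathbb{R}^m$, $R_t(\bar x) = \Psi(x(t,\bar x)) - z(t,\bar x)$ for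 $t \in \{1,\dots,N\}$. Arithmetic means: $\nu_t = \frac1L\sum_{i=1}^L \Psi(x(t,x_i)) \in \mathbb{R}^m$ for $t \in \{0,\dots,N\}$. When $m = N$, $Q_2$ and $A_2$ are empty and the term $A_2Q_2^\top$ is zero. *)

theory Defs
  imports
    "HOL-Probability.Probability"
    "Jordan_Normal_Form.DL_Rank"
    "Jordan_Normal_Form.Gauss_Jordan_Elimination"
begin

unbundle no vec_syntax

text \<open>
  The state space is \<^typ>\<open>real ^ 'n\<close>.  The lifted space has dimension \<open>m\<close> and block matrices
  with \<open>m - N\<close> (possibly zero) columns occur, so all matrices and lifted vectors are those of
  \<^theory>\<open>Jordan_Normal_Form.Matrix\<close>, with explicit dimensions.  Observables and sample
  points are numbered from \<open>0\<close>.
\<close>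

subsection \<open>Square-integrable observables\<close>

definition L2_function :: "(real ^ 'n) set \<Rightarrow> (real ^ 'n \<Rightarrow> real) \<Rightarrow> bool" where
  "L2_function X \<phi> \<longleftrightarrow>
     \<phi> \<in> borel_measurable (lebesgue_on X) \<and> integrable (lebesgue_on X) (\<lambda>x. (\<phi> x)\<^sup>2)"

text \<open>Elements of \<open>L\<^sup>2(X)\<close> are classes modulo equality almost everywhere, so a linear combination
  is zero there iff it vanishes almost everywhere on \<open>X\<close>.\<close>

definition L2_lin_indep :: "(real ^ 'n) set \<Rightarrow> nat \<Rightarrow> (nat \<Rightarrow> real ^ 'n \<Rightarrow> real) \<Rightarrow> bool" where
  "L2_lin_indep X m \<psi> \<longleftrightarrow>
     (\<forall>c :: nat \<Rightarrow> real.
        (AE x in lebesgue_on X. (\<Sum>i<m. c i * \<psi> i x) = 0) \<longrightarrow> (\<forall>i<m. c i = 0))"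

subsection \<open>Lift, trajectories and multi-step residuals\<close>

definition lift :: "nat \<Rightarrow> (nat \<Rightarrow> real ^ 'n \<Rightarrow> real) \<Rightarrow> real ^ 'n \<Rightarrow> real Matrix.vec" where
  "lift m \<psi> x = Matrix.vec m (\<lambda>i. \<psi> i x)"

primrec trajectory :: "('a \<Rightarrow> 'a) \<Rightarrow> nat \<Rightarrow> 'a \<Rightarrow> 'a" where
  "trajectory f 0 x = x"
| "trajectory f (Suc t) x = f (trajectory f t x)"

primrec lifted_trajectory ::
  "real Matrix.mat \<Rightarrow> (real ^ 'n \<Rightarrow> real Matrix.vec) \<Rightarrow> nat \<Rightarrow> real ^ 'n \<Rightarrow> real Matrix.vec" where
  "lifted_trajectory A \<Psi> 0 x = \<Psi> x"
| "lifted_trajectory A \<Psi> (Suc t) x = A *\<^sub>v lifted_trajectory A \<Psi> t x"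

definition residual ::
  "(real ^ 'n \<Rightarrow> real ^ 'n) \<Rightarrow> real Matrix.mat \<Rightarrow> (real ^ 'n \<Rightarrow> real Matrix.vec) \<Rightarrow> nat \<Rightarrow>
   real ^ 'n \<Rightarrow> real Matrix.vec" where
  "residual f A \<Psi> t x = \<Psi> (trajectory f t x) - lifted_trajectory A \<Psi> t x"

definition sample_mean ::
  "nat \<Rightarrow> nat \<Rightarrow> (nat \<Rightarrow> real ^ 'n) \<Rightarrow> (real ^ 'n \<Rightarrow> real Matrix.vec) \<Rightarrow> real Matrix.vec" where
  "sample_mean m L xs Y = (1 / real L) \<cdot>\<^sub>v finsum_vec TYPE(real) m (\<lambda>i. Y (xs i)) {..<L}"

subsection \<open>Expectation with respect to the empirical measure\<close>

text \<open>\<^term>\<open>return M a\<close> is the Dirac measure at \<open>a\<close> on the measurable space \<open>M\<close>.\<close>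

definition empirical_measure ::
  "(real ^ 'n) set \<Rightarrow> nat \<Rightarrow> (nat \<Rightarrow> real ^ 'n) \<Rightarrow> (real ^ 'n) measure" where
  "empirical_measure X L xs =
     measure_of X (sets (restrict_space borel X))
       (\<lambda>E. (\<Sum>i<L. emeasure (return (restrict_space borel X) (xs i)) E) / of_nat L)"

definition vec_expectation ::
  "'a measure \<Rightarrow> nat \<Rightarrow> ('a \<Rightarrow> real Matrix.vec) \<Rightarrow> real Matrix.vec" where
  "vec_expectation M m Y = Matrix.vec m (\<lambda>j. \<integral>x. Y x $ j \<partial>M)"

lemma empirical_measure_eq_distr:
  fixes X :: "(real ^ 'n) set"
  assumes "L > 0" and "\<And>i. i < L \<Longrightarrow> xs i \<in> X"
  shows "empirical_measure X L xs =
    distr (uniform_count_measure {..<L}) (restrict_space borel X) xs" (is "_ = ?D")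
proof -
  let ?M = "restrict_space borel X :: (real ^ 'n) measure"
  have sp: "space ?M = X" by (simp add: space_restrict_space)
  have meas: "xs \<in> measurable (uniform_count_measure {..<L}) ?M"
    using assms(2) by (auto simp: measurable_def space_uniform_count_measure
        sets_uniform_count_measure sp)
  have eq: "(\<Sum>i<L. emeasure (return ?M (xs i)) E) / of_nat L = emeasure ?D E"
    if E: "E \<in> sets ?M" for E
  proof -
    have 1: "xs -` E \<inter> {..<L} = {i \<in> {..<L}. xs i \<in> E}" by auto
    have 2: "(\<Sum>i<L. emeasure (return ?M (xs i)) E) = of_nat (card {i \<in> {..<L}. xs i \<in> E})"
      using E by (simp add: indicator_def sum.If_cases Int_def)
    have 3: "emeasure (uniform_count_measure {..<L}) {i \<in> {..<L}. xs i \<in> E} =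
        ennreal (card {i \<in> {..<L}. xs i \<in> E} / card {..<L})"
      by (rule emeasure_uniform_count_measure) auto
    show ?thesis
      unfolding emeasure_distr[OF meas E] space_uniform_count_measure 1 2 3
      using assms(1) by (simp add: ennreal_of_nat_eq_real_of_nat divide_ennreal)
  qed
  have sub: "sets ?M \<subseteq> Pow X"
    using sets.space_closed[of ?M] by (simp only: sp)
  have sg: "sigma_sets X (sets ?M) = sets ?M"
    using sets.sigma_sets_eq[of ?M] by (simp only: sp)
  have "empirical_measure X L xs = measure_of X (sets ?M) (emeasure ?D)"
    unfolding empirical_measure_def by (rule measure_of_eq[OF sub]) (simp only: sg eq)
  also have "\<dots> = ?D"
    using measure_of_of_measure[of ?D] by (simp add: space_restrict_space)
  finally show ?thesis .
qed

lemma integral_empirical_measure: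
  fixes g :: "real ^ 'n \<Rightarrow> real"
  assumes "L > 0" and "\<And>i. i < L \<Longrightarrow> xs i \<in> X"
    and "g \<in> borel_measurable (restrict_space borel X)"
  shows "(\<integral>x. g x \<partial>empirical_measure X L xs) = (\<Sum>i<L. g (xs i)) / real L"
proof -
  have meas: "xs \<in> measurable (uniform_count_measure {..<L}) (restrict_space borel X)"
    using assms(2) by (auto simp: measurable_def space_uniform_count_measure
        sets_uniform_count_measure space_restrict_space)
  have "(\<integral>x. g x \<partial>empirical_measure X L xs) =
      (\<integral>x. g x \<partial>distr (uniform_count_measure {..<L}) (restrict_space borel X) xs)"
    using assms(1,2) by (subst empirical_measure_eq_distr) simp_all
  then show ?thesis
    unfolding integral_distr[OF meas assms(3)]
    by (simp add: uniform_count_measure_def lebesgue_integral_point_measure_finite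
        sum_divide_distrib)
qed

subsection \<open>QR decomposition\<close>

text \<open>The library's \<^const>\<open>orthogonal_mat\<close> only asks for pairwise orthogonal nonzero columns,
  hence the explicit condition \<open>Q\<^sup>T Q = I\<close>.\<close>

definition qr_decomposition ::
  "real Matrix.mat \<Rightarrow> real Matrix.mat \<Rightarrow> real Matrix.mat \<Rightarrow> real Matrix.mat \<Rightarrow> real Matrix.mat \<Rightarrow> bool" where
  "qr_decomposition B Q Q1 Q2 R \<longleftrightarrow>
     (let m = dim_row B; N = dim_col B in
        Q \<in> carrier_mat m m \<and> transpose_mat Q * Q = 1\<^sub>m m \<and>
        Q1 \<in> carrier_mat m N \<and> Q2 \<in> carrier_mat m (m - N) \<and>
        Q = mat_of_cols m (cols Q1 @ cols Q2) \<and>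
        R \<in> carrier_mat N N \<and> upper_triangular R \<and>
        B = Q * (R @\<^sub>r 0\<^sub>m (m - N) N))"

end

theory Submission
  imports Defs
begin

text \<open>
  The expectation of a residual under the empirical measure is the difference of two arithmetic
  means: \<open>\<mu>\<^sub>t = \<nu>\<^sub>t - \<zeta>\<^sub>t\<close>, where \<open>\<zeta>\<^sub>t\<close> is the mean of the lifted states \<open>z(t, x\<^sub>i)\<close>
  (\<open>expectation_residual\<close>).  The lifted dynamics are linear, so the means obey them too:
  \<open>\<zeta>\<^sub>0 = \<nu>\<^sub>0\<close> and \<open>\<zeta>\<^sub>t\<^sub>+\<^sub>1 = A \<zeta>\<^sub>t\<close> (\<open>sample_mean_mult_mat_vec\<close>).  Hence all \<open>\<mu>\<^sub>t\<close> vanish iff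
  \<open>\<nu>\<^sub>t\<^sub>+\<^sub>1 = A \<nu>\<^sub>t\<close> for \<open>t < N\<close> (\<open>orbit_agrees_iff\<close>), which column by column is the single matrix
  equation \<open>A B = C\<close>.

  It remains to solve this linear equation for \<open>A\<close>.  In \<open>B = Q\<^sub>1 R\<close> the factor \<open>R\<close> is
  invertible, because a nonzero kernel vector of \<open>R\<close> would be one of \<open>B\<close>, contradicting full column rank
  (\<open>full_column_rank_factor_det\<close>).  So \<open>A B = C\<close> amounts to \<open>A Q\<^sub>1 = C R\<^sup>-\<^sup>1\<close>.
  This prescribes \<open>A\<close> on the range of \<open>Q\<^sub>1\<close> and leaves it free on the orthogonal complement, the
  range of \<open>Q\<^sub>2\<close>; splitting \<open>A = A Q\<^sub>1 Q\<^sub>1\<^sup>T + A Q\<^sub>2 Q\<^sub>2\<^sup>T\<close> shows that \<open>A\<^sub>2 = A Q\<^sub>2\<close> is that freedom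
  (\<open>mult_eq_iff_orthogonal_split\<close>).
\<close>

section \<open>Sample means and expectations of residuals\<close>

lemma trajectory_in:
  assumes "\<And>x. x \<in> X \<Longrightarrow> f x \<in> X" and "x \<in> X"
  shows "trajectory f t x \<in> X"
  using assms by (induction t) auto

lemma continuous_on_trajectory:
  assumes "\<And>x. x \<in> X \<Longrightarrow> f x \<in> X" and "continuous_on X f"
  shows "continuous_on X (trajectory f t)"
proof (induction t)
  case (Suc t)
  have "trajectory f t ` X \<subseteq> X"
    using trajectory_in[of X f, OF assms(1)] by auto
  then have "continuous_on X (f \<circ> trajectory f t)"
    by (intro continuous_on_compose Suc continuous_on_subset[OF assms(2)])
  then show ?case by (simp add: o_def)
qed simp

lemma lifted_trajectory_carrier:
  assumes "A \<in> carrier_mat m m" and "\<Psi> x \<in> carrier_vec m"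
  shows "lifted_trajectory A \<Psi> t x \<in> carrier_vec m"
  using assms by (induction t) auto

lemma index_mult_mat_vec_sum:
  assumes "A \<in> carrier_mat n k" and "v \<in> carrier_vec k" and "j < n"
  shows "(A *\<^sub>v v) $ j = (\<Sum>l<k. A $$ (j, l) * v $ l)"
  using assms by (auto simp: scalar_prod_def atLeast0LessThan intro!: sum.cong)

lemma continuous_on_lifted_trajectory:
  assumes A: "A \<in> carrier_mat m m" and \<Psi>: "\<And>x. \<Psi> x \<in> carrier_vec m"
    and "\<And>j. j < m \<Longrightarrow> continuous_on X (\<lambda>x. \<Psi> x $ j)" and "j < m"
  shows "continuous_on X (\<lambda>x. lifted_trajectory A \<Psi> t x $ j)"
  using \<open>j < m\<close>
proof (induction t arbitrary: j)
  case 0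
  then show ?case by (simp add: assms(3))
next
  case (Suc t)
  have "lifted_trajectory A \<Psi> (Suc t) x $ j
      = (\<Sum>l<m. A $$ (j, l) * lifted_trajectory A \<Psi> t x $ l)" for x
    unfolding lifted_trajectory.simps
    by (rule index_mult_mat_vec_sum[OF A lifted_trajectory_carrier[of A m \<Psi>, OF A \<Psi>] Suc.prems])
  moreover have "continuous_on X (\<lambda>x. \<Sum>l<m. A $$ (j, l) * lifted_trajectory A \<Psi> t x $ l)"
    by (intro continuous_intros Suc.IH) auto
  ultimately show ?case by simp
qed

lemma sample_mean_carrier:
  assumes "\<And>i. i < L \<Longrightarrow> Y (xs i) \<in> carrier_vec m"
  shows "sample_mean m L xs Y \<in> carrier_vec m"
  unfolding sample_mean_def
  by (auto intro!: finsum_vec_closed assms)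

lemma index_sample_mean:
  assumes "\<And>i. i < L \<Longrightarrow> Y (xs i) \<in> carrier_vec m" and "j < m"
  shows "sample_mean m L xs Y $ j = (\<Sum>i<L. Y (xs i) $ j) / real L"
proof -
  have "finsum_vec TYPE(real) m (\<lambda>i. Y (xs i)) {..<L} \<in> carrier_vec m"
    by (rule finsum_vec_closed) (use assms in auto)
  moreover have "finsum_vec TYPE(real) m (\<lambda>i. Y (xs i)) {..<L} $ j = (\<Sum>i<L. Y (xs i) $ j)"
    by (rule index_finsum_vec) (use assms in auto)
  ultimately show ?thesis
    using assms(2) by (simp add: sample_mean_def)
qed

text \<open>Linearity of the mean is what transfers the lifted dynamics from the individual samples to
  their average.\<close>

lemma sample_mean_mult_mat_vec:
  assumes A: "A \<in> carrier_mat m m" and Y: "\<And>i. i < L \<Longrightarrow> Y (xs i) \<in> carrier_vec m"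
  shows "sample_mean m L xs (\<lambda>x. A *\<^sub>v Y x) = A *\<^sub>v sample_mean m L xs Y"
proof (rule eq_vecI)
  note AY = mult_mat_vec_carrier[OF A Y]
  note car = sample_mean_carrier[of L Y xs m, OF Y]
  show "dim_vec (sample_mean m L xs (\<lambda>x. A *\<^sub>v Y x)) = dim_vec (A *\<^sub>v sample_mean m L xs Y)"
    using sample_mean_carrier[of L "\<lambda>x. A *\<^sub>v Y x" xs m, OF AY] A by auto
  fix j assume "j < dim_vec (A *\<^sub>v sample_mean m L xs Y)"
  then have j: "j < m" using A by auto
  have "sample_mean m L xs (\<lambda>x. A *\<^sub>v Y x) $ j = (\<Sum>i<L. (A *\<^sub>v Y (xs i)) $ j) / real L"
    by (rule index_sample_mean[of L "\<lambda>x. A *\<^sub>v Y x" xs m, OF AY j])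
  also have "(\<Sum>i<L. (A *\<^sub>v Y (xs i)) $ j) = (\<Sum>i<L. \<Sum>l<m. A $$ (j, l) * Y (xs i) $ l)"
    by (intro sum.cong refl index_mult_mat_vec_sum[OF A Y j]) auto
  also have "\<dots> = (\<Sum>l<m. A $$ (j, l) * (\<Sum>i<L. Y (xs i) $ l))"
    by (subst sum.swap) (simp add: sum_distrib_left)
  also have "\<dots> / real L = (\<Sum>l<m. A $$ (j, l) * sample_mean m L xs Y $ l)"
    by (subst sum_divide_distrib) (simp add: index_sample_mean[of L Y xs m, OF Y])
  also have "\<dots> = (A *\<^sub>v sample_mean m L xs Y) $ j"
    by (rule index_mult_mat_vec_sum[OF A car j, symmetric])
  finally show "sample_mean m L xs (\<lambda>x. A *\<^sub>v Y x) $ j = (A *\<^sub>v sample_mean m L xs Y) $ j" .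
qed

text \<open>Forward invariance and continuity enter the argument here: they make every component of the
  residual Borel measurable on \<open>X\<close>, so that its integral against the Dirac masses is the sum of
  its values.\<close>

lemma expectation_residual:
  fixes f :: "real ^ 'n \<Rightarrow> real ^ 'n" and \<Psi> :: "real ^ 'n \<Rightarrow> real Matrix.vec"
  assumes inv: "\<And>x. x \<in> X \<Longrightarrow> f x \<in> X" and f: "continuous_on X f"
    and A: "A \<in> carrier_mat m m" and \<Psi>: "\<And>x. \<Psi> x \<in> carrier_vec m"
    and cont: "\<And>j. j < m \<Longrightarrow> continuous_on X (\<lambda>x. \<Psi> x $ j)"
    and "L > 0" and xs: "\<And>i. i < L \<Longrightarrow> xs i \<in> X"
  shows "vec_expectation (empirical_measure X L xs) m (residual f A \<Psi> t) =
    sample_mean m L xs (\<lambda>x. \<Psi> (trajectory f t x)) - sample_mean m L xs (lifted_trajectory A \<Psi> t)"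
    (is "?E = sample_mean m L xs ?S - sample_mean m L xs ?Z")
proof (rule eq_vecI)
  have Z: "?Z x \<in> carrier_vec m" for x
    by (rule lifted_trajectory_carrier[OF A \<Psi>])
  have cS: "sample_mean m L xs ?S \<in> carrier_vec m" and cZ: "sample_mean m L xs ?Z \<in> carrier_vec m"
    by (rule sample_mean_carrier, rule \<Psi>) (rule sample_mean_carrier, rule Z)
  show "dim_vec ?E = dim_vec (sample_mean m L xs ?S - sample_mean m L xs ?Z)"
    using cZ by (simp add: vec_expectation_def)
  fix j assume "j < dim_vec (sample_mean m L xs ?S - sample_mean m L xs ?Z)"
  then have j: "j < m" using cZ by auto
  have res: "residual f A \<Psi> t x $ j = ?S x $ j - ?Z x $ j" for x
    using Z[of x] j by (simp add: residual_def)
  have "trajectory f t ` X \<subseteq> X"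
    using trajectory_in[of X f, OF inv] by auto
  then have "continuous_on X (\<lambda>x. ?S x $ j)"
    by (intro continuous_on_compose2[OF cont[OF j] continuous_on_trajectory[OF inv f]])
  then have "continuous_on X (\<lambda>x. residual f A \<Psi> t x $ j)"
    unfolding res
    by (intro continuous_on_diff continuous_on_lifted_trajectory[of A m, OF A \<Psi> cont j])
  then have "(\<lambda>x. residual f A \<Psi> t x $ j) \<in> borel_measurable (restrict_space borel X)"
    by (rule borel_measurable_continuous_on_restrict)
  then have "?E $ j = (\<Sum>i<L. residual f A \<Psi> t (xs i) $ j) / real L"
    using j by (simp add: vec_expectation_def integral_empirical_measure[OF \<open>L > 0\<close> xs])
  also have "\<dots> = sample_mean m L xs ?S $ j - sample_mean m L xs ?Z $ j"
    by (simp add: res sum_subtractf diff_divide_distrib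
        index_sample_mean[of L ?S xs m, OF \<Psi> j] index_sample_mean[of L ?Z xs m, OF Z j])
  also have "\<dots> = (sample_mean m L xs ?S - sample_mean m L xs ?Z) $ j"
    using cZ j by simp
  finally show "?E $ j = (sample_mean m L xs ?S - sample_mean m L xs ?Z) $ j" .
qed

text \<open>Agreement with the orbit of \<open>a\<close> up to time \<open>N\<close> can be tested one step at a time, which turns
  a condition on powers of \<open>g\<close> into one on \<open>g\<close> alone.\<close>

lemma orbit_agrees_iff:
  assumes "b 0 = a 0" and "\<And>t. b (Suc t) = g (b t)"
  shows "(\<forall>t\<in>{1..N}. a t = b t) \<longleftrightarrow> (\<forall>t<N. g (a t) = a (Suc t))"
proof
  assume agree: "\<forall>t\<in>{1..N}. a t = b t"
  have "a t = b t" if "t \<le> N" for t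
    using that agree assms(1) by (cases t) auto
  then show "\<forall>t<N. g (a t) = a (Suc t)"
    using assms(2) by simp
next
  assume step: "\<forall>t<N. g (a t) = a (Suc t)"
  have "a t = b t" if "t \<le> N" for t
    using that step assms by (induction t) (simp, metis Suc_le_eq order_less_imp_le)
  then show "\<forall>t\<in>{1..N}. a t = b t" by simp
qed

lemma mult_mat_of_cols_eq_iff:
  assumes A: "A \<in> carrier_mat k m"
    and v: "\<And>t. v t \<in> carrier_vec m" and w: "\<And>t. w t \<in> carrier_vec k"
  shows "A * mat_of_cols m (map v [0..<N]) = mat_of_cols k (map w [0..<N])
    \<longleftrightarrow> (\<forall>t<N. A *\<^sub>v v t = w t)" (is "A * ?V = ?W \<longleftrightarrow> _")
proof
  have cols: "col ?V t = v t" "col ?W t = w t" if "t < N" for t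
    using that v w by simp_all
  have mult: "col (A * ?V) t = A *\<^sub>v col ?V t" if "t < N" for t
    using that A by (intro col_mult2[of _ k m _ N]) auto
  { assume "A * ?V = ?W"
    then show "\<forall>t<N. A *\<^sub>v v t = w t"
      using cols mult by metis }
  assume "\<forall>t<N. A *\<^sub>v v t = w t"
  then show "A * ?V = ?W"
    using A cols mult by (intro mat_col_eqI) auto
qed

section \<open>Linear equations with a QR-decomposed coefficient matrix\<close>

text \<open>Linear independence is a property of the set of columns, which a repeated column does not
  change; passing from a kernel vector to a dependency therefore requires distinct columns.\<close>

lemma (in vec_space) full_column_rank_distinct_cols:
  assumes A: "A \<in> carrier_mat n nc" and "rank A = nc"
  shows "distinct (cols A)"
proof -
  obtain S where S: "maximal S (\<lambda>T. T \<subseteq> set (cols A) \<and> lin_indpt T)"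
    using maximal_exists_superset[of "set (cols A)" "\<lambda>T. T \<subseteq> set (cols A) \<and> lin_indpt T" "{}"]
      finite_lin_indpt2[of "{}"] by auto
  then have "nc \<le> card (set (cols A))"
    using rank_card_indpt[OF A S] assms(2) by (simp add: maximal_def card_mono)
  then show ?thesis
    using A card_length[of "cols A"] by (intro card_distinct) auto
qed

lemma (in vec_space) full_column_rank_kernel:
  assumes A: "A \<in> carrier_mat n nc" and "rank A = nc"
    and "v \<in> carrier_vec nc" and "A *\<^sub>v v = 0\<^sub>v n"
  shows "v = 0\<^sub>v nc"
  using lin_depI[OF A assms(3) _ assms(4)] full_column_rank_distinct_cols[OF A assms(2)]
    full_rank_lin_indpt[OF A assms(2)] by blast

lemma full_column_rank_factor_det:
  fixes B :: "'a :: field Matrix.mat"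
  assumes "vec_space.rank m B = N" and "B = P * R"
    and P: "P \<in> carrier_mat m N" and R: "R \<in> carrier_mat N N"
  shows "det R \<noteq> 0"
proof
  assume "det R = 0"
  then obtain v where v: "v \<in> carrier_vec N" "v \<noteq> 0\<^sub>v N" "R *\<^sub>v v = 0\<^sub>v N"
    using det_0_iff_vec_prod_zero_field[OF R] by blast
  have "B *\<^sub>v v = P *\<^sub>v (R *\<^sub>v v)"
    unfolding assms(2) by (rule assoc_mult_mat_vec[OF P R v(1)])
  also have "\<dots> = 0\<^sub>v m"
    using P unfolding v(3) by (intro eq_vecI) auto
  finally have "B *\<^sub>v v = 0\<^sub>v m" .
  moreover have "B \<in> carrier_mat m N" using assms by auto
  ultimately show False
    using vec_space.full_column_rank_kernel[of B m N v] v assms(1) by blast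
qed

lemma det_nonzero_mat_inverse:
  fixes R :: "'a :: field Matrix.mat"
  assumes R: "R \<in> carrier_mat n n" and "det R \<noteq> 0"
  shows "R * the (mat_inverse R) = 1\<^sub>m n" and "the (mat_inverse R) * R = 1\<^sub>m n"
    and "the (mat_inverse R) \<in> carrier_mat n n"
proof -
  have "R \<in> Units (ring_mat TYPE('a) n ())"
    by (rule det_non_zero_imp_unit[OF assms])
  then obtain S where S: "mat_inverse R = Some S"
    using mat_inverse(1)[OF R, of "()"] by (cases "mat_inverse R") auto
  show "R * the (mat_inverse R) = 1\<^sub>m n" and "the (mat_inverse R) * R = 1\<^sub>m n"
    and "the (mat_inverse R) \<in> carrier_mat n n"
    using mat_inverse(2)[OF R S] S by auto
qed

lemma mat_of_cols_append_four_block: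
  assumes "P \<in> carrier_mat m k" and "P' \<in> carrier_mat m l"
  shows "mat_of_cols m (cols P @ cols P') = four_block_mat P P' (0\<^sub>m 0 k) (0\<^sub>m 0 l)"
  using assms by (intro eq_matI) (auto simp: mat_of_cols_index nth_append)

lemma four_block_mat_eqD:
  assumes "four_block_mat A B C D = four_block_mat A' B' C' D'"
    and "A \<in> carrier_mat nr1 nc1" "B \<in> carrier_mat nr1 nc2"
      "C \<in> carrier_mat nr2 nc1" "D \<in> carrier_mat nr2 nc2"
    and "A' \<in> carrier_mat nr1 nc1" "B' \<in> carrier_mat nr1 nc2"
      "C' \<in> carrier_mat nr2 nc1" "D' \<in> carrier_mat nr2 nc2"
  shows "A = A'" and "C = C'"
proof -
  have "A $$ (i, j) = A' $$ (i, j)" if "i < nr1" "j < nc1" for i j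
    using arg_cong[OF assms(1), of "\<lambda>M. M $$ (i, j)"] assms(2-) that by simp
  then show "A = A'" using assms by (intro eq_matI) auto
  have "C $$ (i, j) = C' $$ (i, j)" if "i < nr2" "j < nc1" for i j
    using arg_cong[OF assms(1), of "\<lambda>M. M $$ (nr1 + i, j)"] assms(2-) that by simp
  then show "C = C'" using assms by (intro eq_matI) auto
qed

text \<open>The identities for the blocks of \<open>Q = (Q\<^sub>1 Q\<^sub>2)\<close> are read off from \<open>Q\<^sup>T Q = I\<close>, from
  \<open>Q Q\<^sup>T = I\<close>, which follows as \<open>Q\<close> is square, and from \<open>B = Q (R; 0)\<close>.\<close>

lemma qr_decomposition_blocks:
  assumes qr: "qr_decomposition B Q Q1 Q2 R" and B: "B \<in> carrier_mat m N" and "N \<le> m"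
  shows "Q1 \<in> carrier_mat m N" and "Q2 \<in> carrier_mat m (m - N)" and "R \<in> carrier_mat N N"
    and "transpose_mat Q1 * Q1 = 1\<^sub>m N"
    and "transpose_mat Q2 * Q1 = 0\<^sub>m (m - N) N"
    and "Q1 * transpose_mat Q1 + Q2 * transpose_mat Q2 = 1\<^sub>m m"
    and "B = Q1 * R"
proof -
  have Q: "Q \<in> carrier_mat m m" and QQ: "transpose_mat Q * Q = 1\<^sub>m m"
    and Q1: "Q1 \<in> carrier_mat m N" and Q2: "Q2 \<in> carrier_mat m (m - N)"
    and R: "R \<in> carrier_mat N N"
    and Q_cols: "Q = mat_of_cols m (cols Q1 @ cols Q2)"
    and B_eq: "B = Q * (R @\<^sub>r 0\<^sub>m (m - N) N)"
    using qr B unfolding qr_decomposition_def Let_def by auto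
  show "Q1 \<in> carrier_mat m N" "Q2 \<in> carrier_mat m (m - N)" "R \<in> carrier_mat N N"
    by fact+
  have Q_block: "Q = four_block_mat Q1 Q2 (0\<^sub>m 0 N) (0\<^sub>m 0 (m - N))"
    unfolding Q_cols by (rule mat_of_cols_append_four_block[OF Q1 Q2])
  have Q_transpose: "transpose_mat Q =
      four_block_mat (transpose_mat Q1) (0\<^sub>m N 0) (transpose_mat Q2) (0\<^sub>m (m - N) 0)"
    unfolding Q_block by (subst transpose_four_block_mat[OF Q1 Q2]) auto
  have one: "(1\<^sub>m m :: real Matrix.mat) =
      four_block_mat (1\<^sub>m N) (0\<^sub>m N (m - N)) (0\<^sub>m (m - N) N) (1\<^sub>m (m - N))"
    using \<open>N \<le> m\<close> by simp
  have "transpose_mat Q * Q =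
      four_block_mat (transpose_mat Q1 * Q1) (transpose_mat Q1 * Q2)
        (transpose_mat Q2 * Q1) (transpose_mat Q2 * Q2)"
    unfolding Q_transpose unfolding Q_block
    by (subst mult_four_block_mat[of _ N m _ 0 _ "m - N" _ _ N _ "m - N"]) (use Q1 Q2 in auto)
  note gram = this[unfolded QQ one, symmetric]
  show "transpose_mat Q1 * Q1 = 1\<^sub>m N" "transpose_mat Q2 * Q1 = 0\<^sub>m (m - N) N"
    by (rule four_block_mat_eqD[OF gram, of N N "m - N" "m - N"]; use Q1 Q2 in auto)+
  have "Q * transpose_mat Q = four_block_mat (Q1 * transpose_mat Q1 + Q2 * transpose_mat Q2)
      (0\<^sub>m m 0) (0\<^sub>m 0 m) (0\<^sub>m 0 0)"
    unfolding Q_transpose unfolding Q_block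
    by (subst mult_four_block_mat[of _ m N _ "m - N" _ 0 _ _ m _ 0]) (use Q1 Q2 in auto)
  also have "\<dots> = Q1 * transpose_mat Q1 + Q2 * transpose_mat Q2"
    using Q1 Q2 by (intro eq_matI) auto
  also have "Q * transpose_mat Q = 1\<^sub>m m"
    using mat_mult_left_right_inverse[OF _ Q QQ] Q by auto
  finally show "Q1 * transpose_mat Q1 + Q2 * transpose_mat Q2 = 1\<^sub>m m" by simp
  have "B = four_block_mat (Q1 * R) (0\<^sub>m m 0) (0\<^sub>m 0 N) (0\<^sub>m 0 0)"
    unfolding B_eq append_rows_def unfolding Q_block
    by (subst mult_four_block_mat[of _ m N _ "m - N" _ 0 _ _ N _ 0]) (use Q1 Q2 R in auto)
  also have "\<dots> = Q1 * R"
    using Q1 R by (intro eq_matI) auto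
  finally show "B = Q1 * R" .
qed

text \<open>The equation \<open>A B = C\<close> fixes \<open>A\<close> on the range of \<open>Q\<^sub>1\<close>, which is the range of \<open>B\<close>.
  Multiplying the claimed form of \<open>A\<close> by \<open>Q\<^sub>1\<close> kills the term with \<open>Q\<^sub>2\<^sup>T\<close>; conversely,
  \<open>A\<close> is the sum of its restrictions to the two ranges, and \<open>A\<^sub>2 = A Q\<^sub>2\<close> encodes the second.\<close>

lemma mult_eq_iff_orthogonal_split:
  fixes A :: "'a :: comm_ring_1 Matrix.mat"
  assumes A: "A \<in> carrier_mat n m" and C: "C \<in> carrier_mat n N"
    and Q1: "Q1 \<in> carrier_mat m N" and Q2: "Q2 \<in> carrier_mat m k"
    and R: "R \<in> carrier_mat N N" and S: "S \<in> carrier_mat N N"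
    and Q11: "transpose_mat Q1 * Q1 = 1\<^sub>m N" and Q21: "transpose_mat Q2 * Q1 = 0\<^sub>m k N"
    and split: "Q1 * transpose_mat Q1 + Q2 * transpose_mat Q2 = 1\<^sub>m m"
    and RS: "R * S = 1\<^sub>m N" and SR: "S * R = 1\<^sub>m N"
  shows "A * (Q1 * R) = C \<longleftrightarrow>
    (\<exists>A2 \<in> carrier_mat n k. A = C * S * transpose_mat Q1 + A2 * transpose_mat Q2)"
proof
  have T1: "transpose_mat Q1 \<in> carrier_mat N m" and T2: "transpose_mat Q2 \<in> carrier_mat k m"
    using Q1 Q2 by auto
  have AQ1: "A * Q1 \<in> carrier_mat n N" and AQ2: "A * Q2 \<in> carrier_mat n k"
    and CS: "C * S \<in> carrier_mat n N"
    using A Q1 Q2 C S by auto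
  { assume "A * (Q1 * R) = C"
    then have "C * S = (A * Q1) * R * S"
      using assoc_mult_mat[OF A Q1 R] by simp
    also have "\<dots> = (A * Q1) * (R * S)"
      by (rule assoc_mult_mat[OF AQ1 R S])
    also have "\<dots> = A * Q1"
      unfolding RS by (rule right_mult_one_mat[OF AQ1])
    finally have CS_eq: "C * S = A * Q1" .
    have "A = A * (Q1 * transpose_mat Q1 + Q2 * transpose_mat Q2)"
      unfolding split using A by simp
    also have "\<dots> = A * (Q1 * transpose_mat Q1) + A * (Q2 * transpose_mat Q2)"
      by (rule mult_add_distrib_mat[OF A]) (use Q1 Q2 in auto)
    also have "\<dots> = A * Q1 * transpose_mat Q1 + A * Q2 * transpose_mat Q2"
      unfolding assoc_mult_mat[OF A Q1 T1] assoc_mult_mat[OF A Q2 T2] ..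
    also have "\<dots> = C * S * transpose_mat Q1 + A * Q2 * transpose_mat Q2"
      unfolding CS_eq ..
    finally show "\<exists>A2 \<in> carrier_mat n k. A = C * S * transpose_mat Q1 + A2 * transpose_mat Q2"
      using AQ2 by blast }
  assume "\<exists>A2 \<in> carrier_mat n k. A = C * S * transpose_mat Q1 + A2 * transpose_mat Q2"
  then obtain A2 where A2: "A2 \<in> carrier_mat n k"
    and A_eq: "A = C * S * transpose_mat Q1 + A2 * transpose_mat Q2" by blast
  have "A * Q1 = C * S * transpose_mat Q1 * Q1 + A2 * transpose_mat Q2 * Q1"
    unfolding A_eq by (rule add_mult_distrib_mat) (use CS T1 A2 T2 Q1 in auto)
  also have "\<dots> = C * S * (transpose_mat Q1 * Q1) + A2 * (transpose_mat Q2 * Q1)"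
    unfolding assoc_mult_mat[OF CS T1 Q1] assoc_mult_mat[OF A2 T2 Q1] ..
  also have "\<dots> = C * S"
    unfolding Q11 Q21 right_mult_one_mat[OF CS] using CS A2 by simp
  finally have "A * Q1 = C * S" .
  then have "A * (Q1 * R) = C * S * R"
    using assoc_mult_mat[OF A Q1 R] by simp
  also have "\<dots> = C"
    unfolding assoc_mult_mat[OF C S R] SR using C by simp
  finally show "A * (Q1 * R) = C" .
qed

section \<open>Matrices with vanishing mean multi-step residuals\<close>

theorem proposition3:
  fixes f :: "real ^ 'n \<Rightarrow> real ^ 'n"
    and X :: "(real ^ 'n) set"
    and \<psi> :: "nat \<Rightarrow> real ^ 'n \<Rightarrow> real"
    and xs :: "nat \<Rightarrow> real ^ 'n"
    and m L N :: nat
    and \<Psi> :: "real ^ 'n \<Rightarrow> real Matrix.vec"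
    and \<nu> \<mu> :: "nat \<Rightarrow> real Matrix.vec"
    and A B C Q Q1 Q2 R :: "real Matrix.mat"
  assumes "continuous_on UNIV f"
    and "X \<noteq> {}" and "compact X" and "\<And>x. x \<in> X \<Longrightarrow> f x \<in> X"
    and "\<And>i. i < m \<Longrightarrow> continuous_on X (\<psi> i)"
    and "\<And>i. i < m \<Longrightarrow> L2_function X (\<psi> i)"
    and "L2_lin_indep X m \<psi>"
    and "\<Psi> = lift m \<psi>" and "inj_on \<Psi> X"
    and "L \<ge> m" and "\<And>i. i < L \<Longrightarrow> xs i \<in> X"
    and "vec_space.rank m (mat_of_cols m (map (\<lambda>i. \<Psi> (xs i)) [0..<L])) = m"
    and "N \<ge> 1" and "m \<ge> N"
    and "\<And>t. \<nu> t = sample_mean m L xs (\<lambda>x. \<Psi> (trajectory f t x))"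
    and "B = mat_of_cols m (map \<nu> [0..<N])"
    and "vec_space.rank m B = N"
    and "C = mat_of_cols m (map \<nu> [1..<N + 1])"
    and "qr_decomposition B Q Q1 Q2 R"
    and "A \<in> carrier_mat m m"
    and "\<And>t. \<mu> t = vec_expectation (empirical_measure X L xs) m (residual f A \<Psi> t)"
  shows "(\<forall>t\<in>{1..N}. \<mu> t = 0\<^sub>v m) \<longleftrightarrow>
    (\<exists>A2 \<in> carrier_mat m (m - N).
       A = C * the (mat_inverse R) * transpose_mat Q1 + A2 * transpose_mat Q2)"
proof -
  define \<zeta> where "\<zeta> t = sample_mean m L xs (lifted_trajectory A \<Psi> t)" for t
  note inv = assms(4) and xs = assms(11) and A = assms(20)
  have L: "L > 0" using assms(10,13,14) by simp
  have \<Psi>: "\<Psi> x \<in> carrier_vec m" for x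
    by (simp add: assms(8) lift_def)
  have \<Psi>_cont: "continuous_on X (\<lambda>x. \<Psi> x $ j)" if "j < m" for j
    using assms(5)[OF that] that by (simp add: assms(8) lift_def)
  have \<nu>: "\<nu> t \<in> carrier_vec m" for t
    unfolding assms(15) by (rule sample_mean_carrier, rule \<Psi>)
  have z: "lifted_trajectory A \<Psi> t x \<in> carrier_vec m" for t x
    by (rule lifted_trajectory_carrier[OF A \<Psi>])
  have \<zeta>: "\<zeta> t \<in> carrier_vec m" for t
    unfolding \<zeta>_def by (rule sample_mean_carrier, rule z)
  have \<zeta>_0: "\<zeta> 0 = \<nu> 0"
    by (simp add: \<zeta>_def assms(15) sample_mean_def)
  have \<zeta>_Suc: "\<zeta> (Suc t) = A *\<^sub>v \<zeta> t" for t
    using sample_mean_mult_mat_vec[of A m L "lifted_trajectory A \<Psi> t" xs, OF A z]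
    by (simp add: \<zeta>_def sample_mean_def)
  have "\<mu> t = \<nu> t - \<zeta> t" for t
    unfolding assms(21) assms(15) \<zeta>_def
    by (rule expectation_residual[OF inv continuous_on_subset[OF assms(1) subset_UNIV]
          A \<Psi> \<Psi>_cont L xs])
  then have "\<mu> t = 0\<^sub>v m \<longleftrightarrow> \<nu> t = \<zeta> t" for t
    using \<nu>[of t] \<zeta>[of t] by (auto simp: vec_eq_iff)
  then have "(\<forall>t\<in>{1..N}. \<mu> t = 0\<^sub>v m) \<longleftrightarrow> (\<forall>t\<in>{1..N}. \<nu> t = \<zeta> t)"
    by simp
  also have "\<dots> \<longleftrightarrow> (\<forall>t<N. A *\<^sub>v \<nu> t = \<nu> (Suc t))"
    by (rule orbit_agrees_iff[of \<zeta> \<nu> "\<lambda>v. A *\<^sub>v v", OF \<zeta>_0 \<zeta>_Suc])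
  also have "\<dots> \<longleftrightarrow> A * B = C"
  proof -
    have "C = mat_of_cols m (map (\<lambda>t. \<nu> (Suc t)) [0..<N])"
      unfolding assms(18) by (simp add: map_Suc_upt[symmetric] o_def del: upt_Suc)
    then show ?thesis
      unfolding assms(16) using mult_mat_of_cols_eq_iff[OF A, of \<nu> "\<lambda>t. \<nu> (Suc t)", OF \<nu> \<nu>] by simp
  qed
  also have "\<dots> \<longleftrightarrow> (\<exists>A2 \<in> carrier_mat m (m - N).
      A = C * the (mat_inverse R) * transpose_mat Q1 + A2 * transpose_mat Q2)"
  proof -
    have B: "B \<in> carrier_mat m N" and C: "C \<in> carrier_mat m N"
      unfolding assms(16,18) by (auto simp del: upt_Suc)
    note qr = qr_decomposition_blocks[OF assms(19) B assms(14)]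
    note S = det_nonzero_mat_inverse[OF qr(3)
        full_column_rank_factor_det[OF assms(17) qr(7,1,3)]]
    show ?thesis
      using mult_eq_iff_orthogonal_split[OF A C qr(1,2,3) S(3) qr(4,5,6) S(1,2)] qr(7) by simp
  qed
  finally show ?thesis .
qed

end
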